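(* For $m,n\in\mathbb{N}$ we have $$S(n+m,m)=\frac{(-1)^n}{(m-1)!}\sum_{k_1+2k_2+\cdots+nk_n=n}(-1)^{k_1+\cdots+k_n}\frac{(k_1+\cdots+k_n+n+m-1)!}{2^{k_1}k_1!\cdot 3^{k_2}k_2!\cdots (n+1)^{k_n}k_n!}$$ and $$s(n+m,m)=\frac{(-1)^n}{(m-1)!}\sum_{k_1+2k_2+\cdots+nk_n=n}(-1)^{k_1+\cdots+k_n}\frac{(k_1+\cdots+k_n+n+m-1)!}{(2!)^{k_1}k_1!\cdot (3!)^{k_2}k_2!\cdots ((n+1)!)^{k_n}k_n!}.$$
   Context: $\mathbb{N}$ is the set of positive integers. For $n\in\mathbb{N}$ and $k\in\{0,1,\ldots,n\}$, the unsigned Stirling number of the first kind $s(n,k)$ and the Stirling number of the second kind $S(n,k)$ are defined by $$x(x-1)\cdots(x-n+1)=\sum_{k=0}^n(-1)^{n-k}s(n,k)x^k,\qquad x^n=\sum_{k=0}^nS(n,k)\,x(x-1)\cdots(x-k+1).$$ The sums run over all $n$-tuples $(k_1,\ldots,k_n)$ of nonnegative integers with $k_1+2k_2+\cdots+nk_n=n$. *)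

theory Defs
  imports Complex_Main "HOL-Library.FuncSet" "HOL-Combinatorics.Stirling"
begin

text \<open>
  The unsigned Stirling numbers of the first kind and the Stirling numbers of the second kind are
  the library functions \<^const>\<open>stirling\<close> and \<^const>\<open>Stirling\<close>, which are defined by recurrences.
  The next two lemmas are the expansions between powers and falling factorials that characterise
  these numbers.
\<close>

lemma falling_factorial_eq_sum_stirling:
  fixes x :: "'a::comm_ring_1"
  shows "(\<Prod>i<n. x - of_nat i) = (\<Sum>k\<le>n. (- 1) ^ (n - k) * of_nat (stirling n k) * x ^ k)"
proof -
  have sign: "(- 1) ^ n * (- 1) ^ k = (- 1 :: 'a) ^ (n - k)" if "k \<le> n" for k
  proof -
    have "(- 1 :: 'a) ^ n = (- 1) ^ (n - k) * (- 1) ^ k"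
      using that by (simp flip: power_add)
    then show ?thesis
      by (simp add: mult.assoc flip: power_mult_distrib)
  qed
  have "(\<Prod>i<n. x - of_nat i) = (\<Prod>i<n. (- 1) * (- x + of_nat i))"
    by (rule prod.cong) simp_all
  also have "\<dots> = (- 1) ^ n * pochhammer (- x) n"
    by (simp only: prod.distrib pochhammer_prod) (simp add: atLeast0LessThan)
  also have "\<dots> = (\<Sum>k\<le>n. (- 1) ^ n * (of_nat (stirling n k) * (- x) ^ k))"
    by (simp only: sum_distrib_left flip: stirling_pochhammer)
  also have "\<dots> = (\<Sum>k\<le>n. (- 1) ^ (n - k) * of_nat (stirling n k) * x ^ k)"
  proof (rule sum.cong)
    fix k assume "k \<in> {..n}"
    then show "(- 1) ^ n * (of_nat (stirling n k) * (- x) ^ k)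
        = (- 1) ^ (n - k) * of_nat (stirling n k) * x ^ k"
      using sign[of k] power_minus[of x k] by (simp add: mult.commute mult.left_commute flip: sign)
  qed simp
  finally show ?thesis .
qed

lemma power_eq_sum_Stirling:
  fixes x :: "'a::comm_ring_1"
  shows "x ^ n = (\<Sum>k\<le>n. of_nat (Stirling n k) * (\<Prod>i<k. x - of_nat i))"
proof (induction n)
  case 0
  then show ?case by simp
next
  case (Suc n)
  define F where "F k = (\<Prod>i<k. x - of_nat i)" for k
  have F: "x * F k = F (Suc k) + of_nat k * F k" for k
    by (simp add: F_def algebra_simps)
  have "x ^ Suc n = (\<Sum>k\<le>n. of_nat (Stirling n k) * (x * F k))"
    by (simp add: Suc sum_distrib_left F_def mult.left_commute)
  also have "\<dots> = (\<Sum>k\<le>n. of_nat (Stirling n k) * F (Suc k))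
      + (\<Sum>k\<le>n. of_nat (k * Stirling n k) * F k)"
    by (simp add: F algebra_simps sum.distrib)
  also have "(\<Sum>k\<le>n. of_nat (k * Stirling n k) * F k)
      = (\<Sum>k\<le>Suc n. of_nat (k * Stirling n k) * F k)"
    by simp
  also have "\<dots> = (\<Sum>k\<le>n. of_nat (Suc k * Stirling n (Suc k)) * F (Suc k))"
    by (subst sum.atMost_Suc_shift) simp
  also have "(\<Sum>k\<le>n. of_nat (Stirling n k) * F (Suc k)) + \<dots>
      = (\<Sum>k\<le>n. of_nat (Stirling (Suc n) (Suc k)) * F (Suc k))"
    by (simp add: algebra_simps sum.distrib)
  also have "\<dots> = (\<Sum>k\<le>Suc n. of_nat (Stirling (Suc n) k) * F k)"
    by (subst sum.atMost_Suc_shift) simp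
  finally show ?case by (simp only: F_def)
qed

text \<open>
  An \<open>n\<close>-tuple \<open>(k\<^sub>1, \<dots>, k\<^sub>n)\<close> is a function on \<open>{1..n}\<close>, extended by \<^term>\<open>undefined\<close> so that
  each tuple is represented exactly once.
\<close>

definition weighted_tuples :: "nat \<Rightarrow> (nat \<Rightarrow> nat) set" where
  "weighted_tuples n = {k \<in> {1..n} \<rightarrow>\<^sub>E UNIV. (\<Sum>i=1..n. i * k i) = n}"

lemma finite_weighted_tuples: "finite (weighted_tuples n)"
proof (rule finite_subset)
  show "weighted_tuples n \<subseteq> {1..n} \<rightarrow>\<^sub>E {..n}"
  proof
    fix k assume k: "k \<in> weighted_tuples n"
    have "k i \<le> n" if "i \<in> {1..n}" for i
    proof -
      have "k i \<le> i * k i" using that by simp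
      also have "\<dots> \<le> (\<Sum>i=1..n. i * k i)"
        by (rule member_le_sum[OF that]) simp_all
      finally show ?thesis using k by (simp add: weighted_tuples_def)
    qed
    then show "k \<in> {1..n} \<rightarrow>\<^sub>E {..n}"
      using k by (auto simp: weighted_tuples_def PiE_iff)
  qed
qed (simp add: finite_PiE)

end

theory Submission
  imports Defs "HOL-Computational_Algebra.Formal_Power_Series"
begin

text \<open>
  For a power series \<open>G\<close> with constant term 1, the multinomial expansion of \<open>G^(- N)\<close> shows that the
  two sums over tuples are, up to the factor \<open>(n + m - 1)!\<close>, the coefficients of \<open>x^n\<close> in \<open>G^(- (n + m))\<close>
  for \<open>G = - ln (1 - x) / x\<close> and for \<open>G = (e^x - 1) / x\<close>. Each of these \<open>G\<close> satisfies a first-order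
  differential equation, which turns into a recurrence between the coefficients of \<open>G^(- N)\<close> and
  \<open>G^(- N - 1)\<close>. After multiplication by the factorials this is the triangular recurrence of the
  Stirling numbers, so Lagrange inversion is not needed.
\<close>

unbundle fps_syntax

section \<open>Tuples of a given weight and the lowering of one entry\<close>

text \<open>
  The number \<open>r\<close> of entries is kept apart from the weight \<open>n\<close> so that lowering one entry of a tuple
  changes its weight but not its domain.
\<close>

definition bounded_weighted_tuples :: "nat \<Rightarrow> nat \<Rightarrow> (nat \<Rightarrow> nat) set" where
  "bounded_weighted_tuples r n = {k \<in> {1..r} \<rightarrow>\<^sub>E UNIV. (\<Sum>i=1..r. i * k i) = n}"

lemma finite_bounded_weighted_tuples: "finite (bounded_weighted_tuples r n)"
proof (rule finite_subset)
  show "bounded_weighted_tuples r n \<subseteq> {1..r} \<rightarrow>\<^sub>E {..n}"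
  proof
    fix k assume k: "k \<in> bounded_weighted_tuples r n"
    have "k i \<le> n" if "i \<in> {1..r}" for i
    proof -
      have "k i \<le> i * k i" using that by simp
      also have "\<dots> \<le> (\<Sum>i=1..r. i * k i)"
        by (rule member_le_sum[OF that]) simp_all
      finally show ?thesis using k by (simp add: bounded_weighted_tuples_def)
    qed
    then show "k \<in> {1..r} \<rightarrow>\<^sub>E {..n}"
      using k by (auto simp: bounded_weighted_tuples_def PiE_iff)
  qed
qed (simp add: finite_PiE)

lemma bounded_weighted_tuples_0: "bounded_weighted_tuples r 0 = {\<lambda>i\<in>{1..r}. 0}"
  by (auto simp: bounded_weighted_tuples_def PiE_iff extensional_def fun_eq_iff)

lemma sum_fun_upd:
  fixes g :: "'b \<Rightarrow> 'c \<Rightarrow> 'a::ab_group_add"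
  assumes "finite A" "i \<in> A"
  shows "(\<Sum>l\<in>A. g l ((k(i := y)) l)) = (\<Sum>l\<in>A. g l (k l)) - g i (k i) + g i y"
proof -
  have "(\<Sum>l\<in>A - {i}. g l ((k(i := y)) l)) = (\<Sum>l\<in>A - {i}. g l (k l))"
    by (rule sum.cong) auto
  then show ?thesis
    using sum.remove[OF assms, of "\<lambda>l. g l ((k(i := y)) l)"] sum.remove[OF assms, of "\<lambda>l. g l (k l)"]
    by (simp add: algebra_simps)
qed

text \<open>Terms with \<open>k i = 0\<close> vanish, and lowering entry \<open>i\<close> by one
  maps the other tuples bijectively onto those of weight \<open>n - i\<close>. The factor
  \<open>k i\<close> turns \<open>fact (k i)\<close> into \<open>fact (k i - 1)\<close>, and one
  factor \<open>c i\<close> leaves the product.\<close>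

lemma sum_bounded_weighted_tuples_shift:
  fixes c :: "nat \<Rightarrow> 'a::field_char_0" and f :: "nat \<Rightarrow> 'a"
  assumes i: "i \<in> {1..r}" and "i \<le> n"
  shows "(\<Sum>k\<in>bounded_weighted_tuples r n.
            of_nat (k i) * (f (\<Sum>l=1..r. k l) * (\<Prod>l=1..r. c l ^ k l / fact (k l)))) =
         c i * (\<Sum>k\<in>bounded_weighted_tuples r (n - i).
            f (Suc (\<Sum>l=1..r. k l)) * (\<Prod>l=1..r. c l ^ k l / fact (k l)))"
    (is "(\<Sum>k\<in>?T. ?F k) = c i * (\<Sum>k\<in>?T'. ?G k)")
proof -
  have "(\<Sum>k\<in>?T. ?F k) = (\<Sum>k\<in>{k \<in> ?T. k i > 0}. ?F k)"
    by (rule sum.mono_neutral_right) (auto simp: finite_bounded_weighted_tuples)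
  also have "\<dots> = (\<Sum>k\<in>?T'. c i * ?G k)"
  proof (rule sum.reindex_bij_witness[where i = "\<lambda>k. k(i := k i + 1)" and j = "\<lambda>k. k(i := k i - 1)"])
    fix k assume "k \<in> {k \<in> ?T. k i > 0}"
    then have k: "k \<in> {1..r} \<rightarrow>\<^sub>E UNIV" "(\<Sum>l=1..r. l * k l) = n" "k i > 0"
      by (auto simp: bounded_weighted_tuples_def)
    show "(k(i := k i - 1))(i := (k(i := k i - 1)) i + 1) = k"
      using k(3) by auto
    have "(\<Sum>l=1..r. l * (k(i := k i - 1)) l) = n - i"
    proof -
      \<comment> \<open>\<open>sum_fun_upd\<close> subtracts the old entry, so the sum is computed
        in \<open>int\<close>, where nothing is truncated.\<close>
      have "int (\<Sum>l=1..r. l * (k(i := k i - 1)) l) = (\<Sum>l=1..r. int l * int ((k(i := k i - 1)) l))"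
        by simp
      also have "\<dots> = int n - int i"
        using sum_fun_upd[of "{1..r}" i "\<lambda>l y. int l * int y" k "k i - 1"] i k
        by (simp add: of_nat_diff algebra_simps flip: k(2))
      also have "\<dots> = int (n - i)"
        using \<open>i \<le> n\<close> by simp
      finally show ?thesis by (simp only: of_nat_eq_iff)
    qed
    then show "k(i := k i - 1) \<in> ?T'"
      using k(1) i by (auto simp: bounded_weighted_tuples_def PiE_iff extensional_def)
    have sz: "Suc (\<Sum>l=1..r. (k(i := k i - 1)) l) = (\<Sum>l=1..r. k l)"
    proof -
      have "int (Suc (\<Sum>l=1..r. (k(i := k i - 1)) l)) = (\<Sum>l=1..r. int ((k(i := k i - 1)) l)) + 1"
        by simp
      also have "\<dots> = int (\<Sum>l=1..r. k l)"
        using sum_fun_upd[of "{1..r}" i "\<lambda>l y. int y" k "k i - 1"] i k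
        by (simp add: of_nat_diff algebra_simps)
      finally show ?thesis by (simp only: of_nat_eq_iff)
    qed
    obtain y where y: "k i = Suc y" using k(3) gr0_implies_Suc by blast
    \<comment> \<open>In characteristic 0 the factor \<open>k i = Suc y\<close> is nonzero and
      cancels against \<open>fact (k i)\<close>.\<close>
    have nz: "1 + of_nat y \<noteq> (0 :: 'a)"
      by (metis of_nat_Suc of_nat_neq_0)
    have rest: "(\<Prod>l\<in>{1..r}-{i}. c l ^ ((k(i := k i - 1)) l) / fact ((k(i := k i - 1)) l)) =
        (\<Prod>l\<in>{1..r}-{i}. c l ^ k l / fact (k l))"
      by (rule prod.cong) auto
    have "c i * (\<Prod>l=1..r. c l ^ ((k(i := k i - 1)) l) / fact ((k(i := k i - 1)) l)) =
        of_nat (k i) * (\<Prod>l=1..r. c l ^ k l / fact (k l))"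
      by (subst (1 2) prod.remove[OF _ i]) (simp_all only: rest, simp_all add: y nz divide_simps)
    then show "c i * ?G (k(i := k i - 1)) = ?F k"
      unfolding sz by (simp add: mult_ac)
  next
    fix k assume "k \<in> ?T'"
    then have k: "k \<in> {1..r} \<rightarrow>\<^sub>E UNIV" "(\<Sum>l=1..r. l * k l) = n - i"
      by (auto simp: bounded_weighted_tuples_def)
    show "(k(i := k i + 1))(i := (k(i := k i + 1)) i - 1) = k"
      by auto
    have "(\<Sum>l=1..r. l * (k(i := k i + 1)) l) = n"
    proof -
      have "int (\<Sum>l=1..r. l * (k(i := k i + 1)) l) = (\<Sum>l=1..r. int l * int ((k(i := k i + 1)) l))"
        by simp
      also have "\<dots> = int (\<Sum>l=1..r. l * k l) + int i"
        using sum_fun_upd[of "{1..r}" i "\<lambda>l y. int l * int y" k "k i + 1"] i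
        by (simp add: algebra_simps)
      also have "\<dots> = int n"
        using k(2) \<open>i \<le> n\<close> by simp
      finally show ?thesis by (simp only: of_nat_eq_iff)
    qed
    then show "k(i := k i + 1) \<in> {k \<in> ?T. k i > 0}"
      using k(1) i by (auto simp: bounded_weighted_tuples_def PiE_iff extensional_def)
  qed
  finally show ?thesis by (simp add: sum_distrib_left)
qed

lemma bounded_weighted_tuples_eq_0:
  assumes "i \<in> {1..r}" and "n < i" and "k \<in> bounded_weighted_tuples r n"
  shows "k i = 0"
proof (rule ccontr)
  assume "k i \<noteq> 0"
  then have "i \<le> i * k i" by simp
  also have "\<dots> \<le> (\<Sum>l=1..r. l * k l)"
    by (rule member_le_sum[OF assms(1)]) simp_all
  finally show False using assms by (simp add: bounded_weighted_tuples_def)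
qed

section \<open>Coefficients of negative powers of a power series\<close>

lemma pochhammer_Suc_minus:
  fixes N :: "'a::comm_ring_1"
  shows "pochhammer (N + 1) j - of_nat j * pochhammer (N + 1) (j - 1) = pochhammer N j"
proof (cases j)
  \<comment> \<open>Both rising factorials of length \<open>j\<close> contain
    \<open>pochhammer (N + 1) l\<close>; the remaining factors \<open>N + 1 + l\<close> and
    \<open>N\<close> differ by \<open>j\<close>.\<close>
  case (Suc l)
  then show ?thesis
    using pochhammer_Suc[of "N + 1" l] pochhammer_rec[of N l] by (simp add: algebra_simps)
qed simp

text \<open>
  Both sides satisfy the recurrence that compares coefficients in \<open>G * G^(- N - 1) = G^(- N)\<close>; for
  the sums over tuples it comes from lowering one entry.
\<close>
lemma fps_inverse_power_nth:
  fixes G :: "'a::field_char_0 fps"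
  assumes G0: "G $ 0 = 1" and "n \<le> r"
  shows "(inverse G ^ N) $ n =
    (\<Sum>k\<in>bounded_weighted_tuples r n. pochhammer (of_nat N) (\<Sum>i=1..r. k i) *
        (\<Prod>i=1..r. (- (G $ i)) ^ k i / fact (k i)))"
  using \<open>n \<le> r\<close>
proof (induction N arbitrary: n)
  case 0
  let ?w = "\<lambda>k. \<Prod>i=1..r. (- (G $ i)) ^ k i / (fact (k i) :: 'a)"
  show ?case
  proof (cases "n = 0")
    case True
    then show ?thesis by (simp add: bounded_weighted_tuples_0)
  next
    case False
    \<comment> \<open>\<open>pochhammer 0 j\<close> vanishes unless \<open>j = 0\<close>, and a
      tuple of positive weight has a nonzero entry.\<close>
    have "pochhammer (of_nat 0) (\<Sum>i=1..r. k i) * ?w k = 0"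
      if k: "k \<in> bounded_weighted_tuples r n" for k
    proof -
      have "(\<Sum>i=1..r. i * k i) \<noteq> 0"
        using k False unfolding bounded_weighted_tuples_def by blast
      then have "(\<Sum>i=1..r. k i) \<noteq> 0" by auto
      then show ?thesis by (simp only: of_nat_0 pochhammer_0_left if_False mult_zero_left)
    qed
    then have "(\<Sum>k\<in>bounded_weighted_tuples r n. pochhammer (of_nat 0) (\<Sum>i=1..r. k i) * ?w k) = 0"
      by (rule sum.neutral[OF ballI])
    then show ?thesis using False by simp
  qed
next
  case (Suc N)
  let ?w = "\<lambda>k. \<Prod>i=1..r. (- (G $ i)) ^ k i / (fact (k i) :: 'a)"
  define W where "W M n = (\<Sum>k\<in>bounded_weighted_tuples r n.
    pochhammer (of_nat M) (\<Sum>i=1..r. k i) * ?w k)" for M n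
  have IH: "(inverse G ^ N) $ n = W N n" if "n \<le> r" for n
    using Suc.IH[OF that] by (simp add: W_def)
  have GI: "G * inverse G ^ Suc N = inverse G ^ N"
    using G0 inverse_mult_eq_1'[of G] by (simp add: mult.assoc [symmetric])
  have rec: "W N n = W (Suc N) n + (\<Sum>i=1..n. G $ i * W (Suc N) (n - i))" if "n \<le> r" for n
  proof -
    let ?T = "bounded_weighted_tuples r n"
    let ?p = "\<lambda>j. pochhammer (of_nat N + 1 :: 'a) j"
    have poch_diff: "pochhammer (of_nat (Suc N)) j - pochhammer (of_nat N) j =
        of_nat j * ?p (j - 1)" for j
      using pochhammer_Suc_minus[of "of_nat N :: 'a" j] by (simp add: algebra_simps)
    have "W (Suc N) n - W N n =
        (\<Sum>k\<in>?T. (of_nat (\<Sum>i=1..r. k i) * ?p ((\<Sum>i=1..r. k i) - 1)) * ?w k)"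
      unfolding W_def sum_subtractf[symmetric]
      by (simp only: poch_diff flip: left_diff_distrib)
    \<comment> \<open>The factor counting all entries is split into the single \<open>k i\<close>,
      each of which lowers its own entry. Indices \<open>i > n\<close> drop out, since such entries
      are zero in weight \<open>n\<close>.\<close>
    also have "\<dots> = (\<Sum>k\<in>?T. \<Sum>i=1..r. of_nat (k i) * (?p ((\<Sum>i=1..r. k i) - 1) * ?w k))"
      by (simp only: of_nat_sum sum_distrib_right mult.assoc)
    also have "\<dots> = (\<Sum>i=1..r. \<Sum>k\<in>?T. of_nat (k i) * (?p ((\<Sum>i=1..r. k i) - 1) * ?w k))"
      by (rule sum.swap)
    also have "\<dots> = (\<Sum>i=1..n. \<Sum>k\<in>?T. of_nat (k i) * (?p ((\<Sum>i=1..r. k i) - 1) * ?w k))"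
    proof (rule sum.mono_neutral_right)
      show "\<forall>i\<in>{1..r} - {1..n}.
          (\<Sum>k\<in>?T. of_nat (k i) * (?p ((\<Sum>i=1..r. k i) - 1) * ?w k)) = 0"
      proof (intro ballI sum.neutral)
        fix i k assume "i \<in> {1..r} - {1..n}" and "k \<in> ?T"
        then have "k i = 0" by (intro bounded_weighted_tuples_eq_0[of i r n]) auto
        then show "of_nat (k i) * (?p ((\<Sum>i=1..r. k i) - 1) * ?w k) = 0"
          by (simp only: of_nat_0 mult_zero_left)
      qed
    qed (use that in auto)
    also have "\<dots> = (\<Sum>i=1..n. - (G $ i) * W (Suc N) (n - i))"
    proof (rule sum.cong)
      \<comment> \<open>The shift evaluates \<open>f\<close> at a successor, so taking
        \<open>?p\<close> at the predecessor gives back exactly the summand of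
        \<open>W (Suc N)\<close>.\<close>
      fix i assume i: "i \<in> {1..n}"
      then show "(\<Sum>k\<in>?T. of_nat (k i) * (?p ((\<Sum>i=1..r. k i) - 1) * ?w k)) =
          - (G $ i) * W (Suc N) (n - i)"
        using that sum_bounded_weighted_tuples_shift[of i r n "\<lambda>j. ?p (j - 1)" "\<lambda>i. - (G $ i)"]
        by (simp add: W_def add.commute)
    qed simp
    finally show ?thesis by (simp add: sum_negf algebra_simps)
  qed
  \<comment> \<open>As \<open>G $ 0 = 1\<close>, the recurrence determines coefficient
    \<open>n\<close> from those of smaller index, so both solutions agree by strong
    induction.\<close>
  have "(inverse G ^ Suc N) $ n = W (Suc N) n" if "n \<le> r" for n
    using that
  proof (induction n rule: less_induct)
    case (less n)
    have "W N n = (G * inverse G ^ Suc N) $ n"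
      unfolding GI using IH[OF less.prems] by (rule sym)
    also have "\<dots> = (inverse G ^ Suc N) $ n + (\<Sum>i=1..n. G $ i * (inverse G ^ Suc N) $ (n - i))"
      unfolding fps_mult_nth using G0 by (simp add: sum.atLeast_Suc_atMost del: power_Suc)
    also have "(\<Sum>i=1..n. G $ i * (inverse G ^ Suc N) $ (n - i)) =
        (\<Sum>i=1..n. G $ i * W (Suc N) (n - i))"
      using less by (intro sum.cong) auto
    finally show ?case using rec[OF less.prems] by simp
  qed
  then show ?case using Suc.prems by (simp add: W_def)
qed

lemma fps_deriv_inverse_power:
  fixes G :: "'a::field fps"
  assumes "G $ 0 \<noteq> 0"
  shows "fps_deriv (inverse G ^ N) = - of_nat N * fps_deriv G * inverse G ^ Suc N"
proof (induction N)
  case (Suc N)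
  have "fps_deriv (inverse G ^ Suc N) =
      fps_deriv (inverse G) * inverse G ^ N + inverse G * fps_deriv (inverse G ^ N)"
    by (simp add: add.commute)
  also have "\<dots> = - of_nat (Suc N) * fps_deriv G * inverse G ^ Suc (Suc N)"
    unfolding Suc fps_inverse_deriv[OF assms] by (simp add: power2_eq_square algebra_simps)
  finally show ?case .
qed simp

section \<open>The series - ln (1 - x) / x and (e^x - 1) / x and their differential
  equations\<close>

definition fps_ln_quot :: "real fps" where
  "fps_ln_quot = Abs_fps (\<lambda>i. 1 / real (i + 1))"

definition fps_exp_quot :: "real fps" where
  "fps_exp_quot = Abs_fps (\<lambda>i. 1 / fact (i + 1))"

lemma fps_ln_quot_nth_0: "fps_ln_quot $ 0 = 1"
  by (simp add: fps_ln_quot_def)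

lemma fps_exp_quot_nth_0: "fps_exp_quot $ 0 = 1"
  by (simp add: fps_exp_quot_def)

text \<open>The second factor is the derivative of \<open>x * G = - ln (1 - x)\<close>, which is the
  geometric series.\<close>

lemma fps_ln_quot_ode:
  "(1 - fps_X) * (fps_ln_quot + fps_X * fps_deriv fps_ln_quot) = 1"
proof -
  have "fps_ln_quot + fps_X * fps_deriv fps_ln_quot = Abs_fps (\<lambda>_. 1)"
  proof (rule fps_ext)
    fix n show "(fps_ln_quot + fps_X * fps_deriv fps_ln_quot) $ n = Abs_fps (\<lambda>_. 1) $ n"
      by (cases n) (simp_all add: fps_ln_quot_def divide_simps)
  qed
  moreover have "(1 - fps_X) * Abs_fps (\<lambda>_. 1 :: real) = 1"
  proof (rule fps_ext)
    fix n show "((1 - fps_X) * Abs_fps (\<lambda>_. 1 :: real)) $ n = 1 $ n"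
      by (cases n) (simp_all add: algebra_simps)
  qed
  ultimately show ?thesis by simp
qed

text \<open>Both sides are e^x: the left one as the derivative of
  \<open>x * G = e^x - 1\<close>.\<close>

lemma fps_exp_quot_ode:
  "fps_exp_quot + fps_X * fps_deriv fps_exp_quot = 1 + fps_X * fps_exp_quot"
proof (rule fps_ext)
  fix n show "(fps_exp_quot + fps_X * fps_deriv fps_exp_quot) $ n = (1 + fps_X * fps_exp_quot) $ n"
    by (cases n) (simp_all add: fps_exp_quot_def divide_simps)
qed

text \<open>With \<open>P N = G^(- N)\<close>, the derivative rule gives
  \<open>N * P N - x * (P N)' = N * (G + x * G') * P (N + 1)\<close>. Multiplying by
  \<open>1 - x\<close> removes the bracket. Coefficient \<open>j\<close> of the left side is
  \<open>(N - j) * P N $ j\<close>.\<close>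

lemma inverse_fps_ln_quot_power_rec:
  "real N * (inverse fps_ln_quot ^ Suc N) $ Suc k =
    (real N - real (Suc k)) * (inverse fps_ln_quot ^ N) $ Suc k
    - (real N - real k) * (inverse fps_ln_quot ^ N) $ k"
proof -
  let ?G = fps_ln_quot
  let ?P = "\<lambda>N. inverse ?G ^ N"
  have PG: "?G * ?P (Suc N) = ?P N"
    using inverse_mult_eq_1'[of ?G] fps_ln_quot_nth_0 by (simp add: mult.assoc[symmetric])
  have D: "fps_deriv (?P N) = - of_nat N * fps_deriv ?G * ?P (Suc N)"
    by (rule fps_deriv_inverse_power) (simp add: fps_ln_quot_nth_0)
  have "(1 - fps_X) * (of_nat N * ?P N - fps_X * fps_deriv (?P N)) =
      of_nat N * ((1 - fps_X) * (?G + fps_X * fps_deriv ?G)) * ?P (Suc N)"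
    unfolding D unfolding PG[symmetric] by (simp add: algebra_simps del: power_Suc)
  then have "of_nat N * ?P (Suc N) = (1 - fps_X) * (of_nat N * ?P N - fps_X * fps_deriv (?P N))"
    by (simp only: fps_ln_quot_ode mult_1_right)
  then have "(of_nat N * ?P (Suc N)) $ Suc k =
     ((of_nat N * ?P N - fps_X * fps_deriv (?P N)) -
       fps_X * (of_nat N * ?P N - fps_X * fps_deriv (?P N))) $ Suc k"
    by (simp only: left_diff_distrib mult_1_left)
  then show ?thesis
    by (cases k) (simp_all add: algebra_simps del: power_Suc)
qed

text \<open>The same computation, except that the bracket becomes 1 after subtracting
  \<open>x * G\<close>; this contributes the term \<open>N * x * P N\<close>.\<close>

lemma inverse_fps_exp_quot_power_rec:
  "real N * (inverse fps_exp_quot ^ Suc N) $ Suc k =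
    (real N - real (Suc k)) * (inverse fps_exp_quot ^ N) $ Suc k
    - real N * (inverse fps_exp_quot ^ N) $ k"
proof -
  let ?G = fps_exp_quot
  let ?P = "\<lambda>N. inverse ?G ^ N"
  have PG: "?G * ?P (Suc N) = ?P N"
    using inverse_mult_eq_1'[of ?G] fps_exp_quot_nth_0 by (simp add: mult.assoc[symmetric])
  have D: "fps_deriv (?P N) = - of_nat N * fps_deriv ?G * ?P (Suc N)"
    by (rule fps_deriv_inverse_power) (simp add: fps_exp_quot_nth_0)
  have "of_nat N * ?P N - fps_X * fps_deriv (?P N) - of_nat N * (fps_X * ?P N) =
      of_nat N * ((?G + fps_X * fps_deriv ?G) - fps_X * ?G) * ?P (Suc N)"
    unfolding D unfolding PG[symmetric] by (simp add: algebra_simps del: power_Suc)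
  also have "\<dots> = of_nat N * ?P (Suc N)"
    by (simp add: fps_exp_quot_ode del: power_Suc)
  finally have "(of_nat N * ?P (Suc N)) $ Suc k =
      (of_nat N * ?P N - fps_X * fps_deriv (?P N) - of_nat N * (fps_X * ?P N)) $ Suc k"
    by simp
  then show ?thesis
    by (simp add: algebra_simps del: power_Suc)
qed

section \<open>Stirling numbers as coefficients\<close>

text \<open>The triangular recurrence lowers either \<open>n\<close> or \<open>m\<close> by one,
  hence the induction on \<open>n + m\<close>. Both predecessors belong to the same power of the
  series.\<close>

lemma Stirling_eq_nth:
  "real (Stirling (n + Suc m) (Suc m)) * fact m =
    (- 1) ^ n * fact (n + m) * (inverse fps_ln_quot ^ (n + Suc m)) $ n"
proof (induction "n + m" arbitrary: n m)
  case 0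
  then show ?case by (simp add: fps_ln_quot_nth_0)
next
  case (Suc N)
  show ?case
  proof (cases n)
    case 0
    then show ?thesis by (simp add: fps_ln_quot_nth_0 fps_nth_power_0 del: power_Suc)
  next
    case (Suc k)
    let ?a = "\<lambda>j. (inverse fps_ln_quot ^ (k + Suc m)) $ j"
    \<comment> \<open>For the exponent \<open>N = k + Suc m\<close> the factors
      \<open>N - Suc k\<close> and \<open>N - k\<close> are \<open>m\<close> and
      \<open>Suc m\<close>, and the latter is the weight in the Stirling recurrence.\<close>
    have r: "real (k + Suc m) * (inverse fps_ln_quot ^ (n + Suc m)) $ n =
        real m * ?a n - real (Suc m) * ?a k"
      using inverse_fps_ln_quot_power_rec[of "k + Suc m" k] Suc by (simp add: algebra_simps)
    have 1: "real (Stirling (k + Suc m) (Suc m)) * fact m = (- 1) ^ k * fact (k + m) * ?a k"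
      using Suc.hyps Suc by auto
    \<comment> \<open>For positive \<open>m\<close> the factor \<open>real m\<close> comes from
      \<open>fact m = m * fact (m - 1)\<close>; for \<open>m = 0\<close> both sides vanish.\<close>
    have 2: "real (Stirling (k + Suc m) m) * fact m = (- 1) ^ n * fact (k + m) * (real m * ?a n)"
    proof (cases m)
      case (Suc m')
      then show ?thesis
        using Suc.hyps(1)[of n m'] Suc.hyps(2) \<open>n = Suc k\<close> by (simp del: power_Suc Stirling.simps) 
    qed simp
    have "real (Stirling (n + Suc m) (Suc m)) * fact m =
        real (Suc m) * (real (Stirling (k + Suc m) (Suc m)) * fact m) +
        real (Stirling (k + Suc m) m) * fact m"
      using Suc by (simp add: algebra_simps)
    also have "\<dots> = (- 1) ^ n * fact (k + m) * (real m * ?a n - real (Suc m) * ?a k)"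
      unfolding 1 2 using Suc by (simp add: algebra_simps)
    also have "\<dots> = (- 1) ^ n * fact (n + m) * (inverse fps_ln_quot ^ (n + Suc m)) $ n"
      unfolding r[symmetric] using Suc by (simp add: algebra_simps del: power_Suc)
    finally show ?thesis .
  qed
qed

text \<open>The induction is as for \<open>Stirling_eq_nth\<close>; the recurrence weight is now
  \<open>k + Suc m\<close>, the exponent itself, as in the recurrence for the exponential
  series.\<close>

lemma stirling_eq_nth:
  "real (stirling (n + Suc m) (Suc m)) * fact m =
    (- 1) ^ n * fact (n + m) * (inverse fps_exp_quot ^ (n + Suc m)) $ n"
proof (induction "n + m" arbitrary: n m)
  case 0
  then show ?case by (simp add: fps_exp_quot_nth_0)
next
  case (Suc N)
  show ?case
  proof (cases n)
    case 0
    then show ?thesis by (simp add: fps_exp_quot_nth_0 fps_nth_power_0 del: power_Suc)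
  next
    case (Suc k)
    let ?a = "\<lambda>j. (inverse fps_exp_quot ^ (k + Suc m)) $ j"
    have r: "real (k + Suc m) * (inverse fps_exp_quot ^ (n + Suc m)) $ n =
        real m * ?a n - real (k + Suc m) * ?a k"
      using inverse_fps_exp_quot_power_rec[of "k + Suc m" k] Suc by (simp add: algebra_simps)
    have 1: "real (stirling (k + Suc m) (Suc m)) * fact m = (- 1) ^ k * fact (k + m) * ?a k"
      using Suc.hyps Suc by auto
    have 2: "real (stirling (k + Suc m) m) * fact m = (- 1) ^ n * fact (k + m) * (real m * ?a n)"
    proof (cases m)
      case (Suc m')
      then show ?thesis
        using Suc.hyps(1)[of n m'] Suc.hyps(2) \<open>n = Suc k\<close> by (simp del: power_Suc stirling.simps)
    qed simp
    have "real (stirling (n + Suc m) (Suc m)) * fact m =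
        real (k + Suc m) * (real (stirling (k + Suc m) (Suc m)) * fact m) +
        real (stirling (k + Suc m) m) * fact m"
      using Suc by (simp add: algebra_simps)
    also have "\<dots> = (- 1) ^ n * fact (k + m) * (real m * ?a n - real (k + Suc m) * ?a k)"
      unfolding 1 2 using Suc by (simp add: algebra_simps)
    also have "\<dots> = (- 1) ^ n * fact (n + m) * (inverse fps_exp_quot ^ (n + Suc m)) $ n"
      unfolding r[symmetric] using Suc by (simp add: algebra_simps del: power_Suc)
    finally show ?thesis .
  qed
qed

section \<open>From coefficients back to sums over tuples\<close>

text \<open>The factor \<open>fact N\<close> completes the rising factorial from
  \<open>N + 1\<close> to a factorial. Coefficients of \<open>G\<close> move to the denominator as
  reciprocals, which are \<open>i + 1\<close> and \<open>fact (i + 1)\<close> for the two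
  series.\<close>

lemma fact_times_inverse_power_nth:
  fixes G :: "real fps"
  assumes "G $ 0 = 1"
  shows "fact N * (inverse G ^ Suc N) $ n =
    (\<Sum>k\<in>weighted_tuples n. (- 1) ^ (\<Sum>i=1..n. k i) * fact ((\<Sum>i=1..n. k i) + N)
        / (\<Prod>i=1..n. inverse (G $ i) ^ k i * fact (k i)))"
proof -
  have poch: "fact N * pochhammer (of_nat (Suc N)) j = (fact (j + N) :: real)" for j
    using pochhammer_product'[of "1::real" N j] by (simp add: pochhammer_fact add.commute)
  have weight: "(\<Prod>i=1..n. (- (G $ i)) ^ k i / fact (k i)) =
      (- 1) ^ (\<Sum>i=1..n. k i) / (\<Prod>i=1..n. inverse (G $ i) ^ k i * fact (k i))" for k
  proof -
    \<comment> \<open>This also holds for \<open>G $ i = 0\<close>, because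
      \<open>inverse 0 = 0\<close> and division by 0 gives 0.\<close>
    have "(- (G $ i)) ^ k i / fact (k i) = (- 1) ^ k i / (inverse (G $ i) ^ k i * fact (k i))" for i
      by (subst power_minus) (simp add: power_inverse divide_inverse)
    then show ?thesis by (simp add: prod_dividef power_sum)
  qed
  have tuples: "bounded_weighted_tuples n n = weighted_tuples n"
    by (simp add: bounded_weighted_tuples_def weighted_tuples_def)
  show ?thesis
    unfolding fps_inverse_power_nth[where G = G, OF assms order_refl] sum_distrib_left tuples weight
    by (rule sum.cong) (simp_all flip: poch)
qed

theorem theorem4p2:
  fixes m n :: nat
  assumes "m \<ge> 1" and "n \<ge> 1"
  shows "real (Stirling (n + m) m) =
      (- 1) ^ n / fact (m - 1) *
      (\<Sum>k \<in> weighted_tuples n.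
        (- 1) ^ (\<Sum>i=1..n. k i) * fact ((\<Sum>i=1..n. k i) + n + m - 1)
          / (\<Prod>i=1..n. real (i + 1) ^ k i * fact (k i)))
    \<and> real (stirling (n + m) m) =
      (- 1) ^ n / fact (m - 1) *
      (\<Sum>k \<in> weighted_tuples n.
        (- 1) ^ (\<Sum>i=1..n. k i) * fact ((\<Sum>i=1..n. k i) + n + m - 1)
          / (\<Prod>i=1..n. fact (i + 1) ^ k i * fact (k i)))"
proof -
  obtain m' where m: "m = Suc m'" using assms(1) by (cases m) auto
  note L = fact_times_inverse_power_nth[OF fps_ln_quot_nth_0, of "n + m'" n]
  note E = fact_times_inverse_power_nth[OF fps_exp_quot_nth_0, of "n + m'" n]
  \<comment> \<open>With \<open>m = Suc m'\<close> the exponent \<open>n + m\<close> is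
    \<open>Suc (n + m')\<close>, so \<open>N = n + m'\<close> produces the shift
    \<open>n + m - 1\<close> in the factorials.\<close>
  have "real (Stirling (n + m) m) = (- 1) ^ n / fact (m - 1) *
      (fact (n + m') * (inverse fps_ln_quot ^ Suc (n + m')) $ n)"
    using Stirling_eq_nth[of n m'] by (simp add: m field_simps del: power_Suc Stirling.simps)
  moreover have "real (stirling (n + m) m) = (- 1) ^ n / fact (m - 1) *
      (fact (n + m') * (inverse fps_exp_quot ^ Suc (n + m')) $ n)"
    using stirling_eq_nth[of n m'] by (simp add: m field_simps del: power_Suc stirling.simps)
  ultimately show ?thesis
    unfolding L E by (simp add: m fps_ln_quot_def fps_exp_quot_def add.assoc del: fact_Suc of_nat_Suc)
qed

end
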